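(* Let $G$ be a finite graph and let $S$ be a nonempty subset of its vertex set. Then $$W_S(t)=\left(I-W_S^*(t)\right)^{-1}.$$
   Context: The graph $G$ may be directed and may have loops (and may be weighted, in which case each walk is counted with weight the product of the weights of its edges). $W_S(t)=\sum_{\ell=0}^\infty w_\ell(S)t^\ell$, where $w_\ell(S)$ is the $|S|\times|S|$ matrix whose $(a,b)$ entry is the number of walks of length $\ell$ in $G$ beginning at $a$ and ending at $b$; equivalently $W_S(t)=\left((I-tA)^{-1}\right)_{S,S}$ with $A$ the adjacency matrix of $G$. $W_S^*(t)=\sum_{\ell=1}^\infty w_\ell^*(S)t^\ell$, where $w_\ell^*(S)$ is the $|S|\times|S|$ matrix whose $(a,b)$ entry is the number of walks of length $\ell$ from $a$ to $b$ in $G$ that are $S$-non-returning, i.e. all of whose vertices strictly between the first and the last lie outside $S$ (so every walk of length $1$ from $a\in S$ to $b\in S$ is counted). Both are viewed as formal power series in $t$ with matrix coefficients. *)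

theory Defs
  imports
    "Graph_Theory.Graph_Theory"
    "Jordan_Normal_Form.Matrix"
    "HOL-Computational_Algebra.Formal_Power_Series"
begin

text \<open>
  A graph is a \<open>fin_digraph\<close>: it is finite and directed, and loops and parallel arcs are allowed.
  An undirected graph is the symmetric digraph that has one arc for each direction of traversal of
  an edge.  Each arc \<open>e\<close> carries a weight \<open>c e\<close>, and a walk is counted with the product of the
  weights of its arcs; unweighted counting is the case where \<open>c\<close> is constantly \<open>1\<close>
  (see \<open>card_walk_weight\<close> below).
\<close>

definition walks :: "('v, 'e) pre_digraph \<Rightarrow> nat \<Rightarrow> 'v \<Rightarrow> 'v \<Rightarrow> 'e list set" where
  "walks G l a b = {p. pre_digraph.awalk G a p b \<and> length p = l}"

text \<open>
  For a walk with vertices $v_0, \ldots, v_l$, the list \<open>inner_verts\<close> is $v_1, \ldots, v_{l-1}$;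
  it is empty if the length is at most one.
\<close>

definition nonret_walks ::
  "('v, 'e) pre_digraph \<Rightarrow> 'v set \<Rightarrow> nat \<Rightarrow> 'v \<Rightarrow> 'v \<Rightarrow> 'e list set" where
  "nonret_walks G S l a b =
     {p \<in> walks G l a b. set (pre_digraph.inner_verts G p) \<inter> S = {}}"

definition walk_weight :: "('e \<Rightarrow> 'r :: comm_ring_1) \<Rightarrow> 'e list set \<Rightarrow> 'r" where
  "walk_weight c P = (\<Sum>p\<in>P. prod_list (map c p))"

text \<open>
  Rows and columns of the matrices belong to the elements of \<open>S\<close>, in the order in which they are
  listed in \<open>vs\<close>; the list is meant to be distinct with \<open>set vs = S\<close>.
\<close>

definition walk_mat ::
  "('v, 'e) pre_digraph \<Rightarrow> ('e \<Rightarrow> 'r :: comm_ring_1) \<Rightarrow> 'v list \<Rightarrow> nat \<Rightarrow> 'r mat" where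
  "walk_mat G c vs l =
     mat (length vs) (length vs) (\<lambda>(i, j). walk_weight c (walks G l (vs ! i) (vs ! j)))"

definition nonret_walk_mat ::
  "('v, 'e) pre_digraph \<Rightarrow> ('e \<Rightarrow> 'r :: comm_ring_1) \<Rightarrow> 'v list \<Rightarrow> nat \<Rightarrow> 'r mat" where
  "nonret_walk_mat G c vs l =
     mat (length vs) (length vs)
       (\<lambda>(i, j). walk_weight c (nonret_walks G (set vs) l (vs ! i) (vs ! j)))"

text \<open>
  The power series $\sum_l M_l t^l$ with coefficients in the $n \times n$ matrices over a ring
  \<open>R\<close> is represented by the matrix over \<open>R[[t]]\<close> whose $(i,j)$ entry is
  $\sum_l (M_l)_{ij} t^l$.  Under this identification the matrix product is the Cauchy product
  (lemma \<open>mat_series_mult_coeff\<close>) and \<open>1\<^sub>m n\<close> is the constant series \<open>I\<close>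
  (lemma \<open>mat_series_one\<close>).
\<close>

definition mat_series :: "nat \<Rightarrow> (nat \<Rightarrow> 'r mat) \<Rightarrow> 'r fps mat" where
  "mat_series n M = mat n n (\<lambda>(i, j). Abs_fps (\<lambda>l. M l $$ (i, j)))"

definition walk_gf ::
  "('v, 'e) pre_digraph \<Rightarrow> ('e \<Rightarrow> 'r :: comm_ring_1) \<Rightarrow> 'v list \<Rightarrow> 'r fps mat" where
  "walk_gf G c vs = mat_series (length vs) (walk_mat G c vs)"

text \<open>The series of non-returning walks starts at length one, so its constant term vanishes.\<close>

definition nonret_walk_gf ::
  "('v, 'e) pre_digraph \<Rightarrow> ('e \<Rightarrow> 'r :: comm_ring_1) \<Rightarrow> 'v list \<Rightarrow> 'r fps mat" where
  "nonret_walk_gf G c vs =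
     mat_series (length vs)
       (\<lambda>l. if l = 0 then 0\<^sub>m (length vs) (length vs) else nonret_walk_mat G c vs l)"

lemma finite_walks:
  assumes "fin_digraph G"
  shows "finite (walks G l a b)"
proof (rule finite_subset)
  show "walks G l a b \<subseteq> {p. set p \<subseteq> arcs G \<and> length p = l}"
    by (auto simp: walks_def pre_digraph.awalk_def)
  show "finite {p. set p \<subseteq> arcs G \<and> length p = l}"
    using assms by (intro finite_lists_length_eq) (simp add: fin_digraph.finite_arcs)
qed

lemma card_walk_weight:
  fixes P :: "'e list set"
  shows "walk_weight (\<lambda>_. 1) P = (of_nat (card P) :: 'r :: comm_ring_1)"
proof -
  have "prod_list (map (\<lambda>_. 1 :: 'r) p) = 1" for p :: "'e list"
    by (induction p) auto
  then show ?thesis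
    by (simp add: walk_weight_def)
qed

lemma mat_series_one:
  "mat_series n (\<lambda>l. if l = 0 then 1\<^sub>m n else 0\<^sub>m n n) = (1\<^sub>m n :: 'r :: comm_ring_1 fps mat)"
  by (rule eq_matI) (auto simp: mat_series_def fps_eq_iff)

lemma mat_series_mult_coeff:
  fixes M N :: "nat \<Rightarrow> 'r :: comm_ring_1 mat"
  assumes "\<And>l. M l \<in> carrier_mat n n" "\<And>l. N l \<in> carrier_mat n n" "i < n" "j < n"
  shows "fps_nth ((mat_series n M * mat_series n N) $$ (i, j)) l =
    (\<Sum>k=0..l. (M k * N (l - k)) $$ (i, j))"
proof -
  have "(M k * N m) $$ (i, j) = (\<Sum>r = 0..<n. M k $$ (i, r) * N m $$ (r, j))" for k m
    using assms(1)[of k] assms(2)[of m] assms(3,4) by (auto simp: scalar_prod_def)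
  moreover have "fps_nth ((mat_series n M * mat_series n N) $$ (i, j)) l =
      (\<Sum>r = 0..<n. \<Sum>k=0..l. M k $$ (i, r) * N (l - k) $$ (r, j))"
    using assms(3,4) by (auto simp: mat_series_def scalar_prod_def fps_sum_nth fps_mult_nth)
  ultimately show ?thesis
    by (simp add: sum.swap[of _ "{0..l}"])
qed

end

theory Submission
  imports Defs "Jordan_Normal_Form.Determinant"
begin

text \<open>
  Cutting a walk that ends in \<open>S\<close> at its first return to \<open>S\<close> gives
  \<open>W = I + W\<^sup>* W\<close>, so \<open>W\<close> is a right inverse of \<open>I - W\<^sup>*\<close>.  The cut is done by induction on the
  length: both kinds of walks satisfy a recursion that splits off the first arc, and the walk
  returns at once or not according to whether the head of that arc lies in \<open>S\<close>.  Over a commutative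
  ring a right inverse of a square matrix is a left inverse, by means of the adjugate.
\<close>

text \<open>\<open>det B\<close> inverts \<open>det A\<close>, so \<open>det B\<close> times the
  adjugate is a left inverse of \<open>A\<close>; by associativity a left inverse and a right
  inverse coincide.\<close>

lemma comm_ring_mat_mult_left_right_inverse:
  fixes A B :: "'a :: comm_ring_1 mat"
  assumes A: "A \<in> carrier_mat n n" and B: "B \<in> carrier_mat n n" and AB: "A * B = 1\<^sub>m n"
  shows "B * A = 1\<^sub>m n"
proof -
  define X where "X = det B \<cdot>\<^sub>m adj_mat A"
  have X: "X \<in> carrier_mat n n"
    using adj_mat(1)[OF A] by (simp add: X_def)
  have "det B * det A = 1"
    using det_mult[OF A B] AB by (simp add: mult.commute)
  then have XA: "X * A = 1\<^sub>m n"
    using adj_mat(1,3)[OF A] A by (auto simp: X_def mult_smult_assoc_mat[where nr = n and n = n and nc = n])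
  have "B = (X * A) * B"
    using B XA by simp
  also have "\<dots> = X"
    using X A B AB by (simp add: assoc_mult_mat[where ?n\<^sub>1.0 = n and ?n\<^sub>2.0 = n and ?n\<^sub>3.0 = n and ?n\<^sub>4.0 = n])
  finally show ?thesis
    using XA by simp
qed

text \<open>Lists with different first arcs differ, so the union is disjoint. This turns a first-arc
  splitting of walk sets into a recursion for weights.\<close>

lemma walk_weight_UN_Cons:
  assumes "finite E" and "\<And>e. e \<in> E \<Longrightarrow> finite (P e)"
  shows "walk_weight c (\<Union>e\<in>E. (#) e ` P e) = (\<Sum>e\<in>E. c e * walk_weight c (P e))"
proof -
  have "walk_weight c (\<Union>e\<in>E. (#) e ` P e) = (\<Sum>e\<in>E. walk_weight c ((#) e ` P e))"
    unfolding walk_weight_def using assms by (intro sum.UNION_disjoint) auto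
  also have "\<dots> = (\<Sum>e\<in>E. c e * walk_weight c (P e))"
    by (simp add: walk_weight_def sum.reindex sum_distrib_left)
  finally show ?thesis .
qed

context fin_digraph
begin

lemma finite_nonret_walks: "finite (nonret_walks G S l a b)"
  using finite_walks[OF fin_digraph_axioms] by (simp add: nonret_walks_def)

lemma walk_weight_walks_0:
  "walk_weight c (walks G 0 u b) = (if u = b \<and> u \<in> verts G then 1 else 0)"
proof -
  have "walks G 0 u b = (if u = b \<and> u \<in> verts G then {[]} else {})"
    by (auto simp: walks_def awalk_Nil_iff)
  then show ?thesis
    by (auto simp: walk_weight_def)
qed

lemma walk_weight_walks_Suc:
  "walk_weight c (walks G (Suc l) u b) =
    (\<Sum>e\<in>out_arcs G u. c e * walk_weight c (walks G l (head G e) b))"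
proof -
  have "walks G (Suc l) u b = (\<Union>e\<in>out_arcs G u. (#) e ` walks G l (head G e) b)"
    by (auto simp: walks_def length_Suc_conv awalk_Cons_iff)
  then show ?thesis
    by (simp add: walk_weight_UN_Cons finite_out_arcs finite_walks[OF fin_digraph_axioms])
qed

lemma walk_weight_nonret_walks_1:
  "walk_weight c (nonret_walks G S (Suc 0) u b) =
    (\<Sum>e\<in>out_arcs G u. c e * (if head G e = b then 1 else 0))"
proof -
  have "nonret_walks G S (Suc 0) u b = walks G (Suc 0) u b"
    by (auto simp: nonret_walks_def walks_def inner_verts_def length_Suc_conv)
  then show ?thesis
    by (auto simp: walk_weight_walks_Suc walk_weight_walks_0 intro!: sum.cong)
qed

text \<open>As \<open>k > 0\<close>, the head of the first arc is an inner vertex and must avoid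
  \<open>S\<close>; for \<open>k = 0\<close> it would be the endpoint, which may lie in
  \<open>S\<close>.\<close>

lemma walk_weight_nonret_walks_Suc:
  assumes "k > 0"
  shows "walk_weight c (nonret_walks G S (Suc k) u b) =
    (\<Sum>e\<in>out_arcs G u. c e *
       (if head G e \<in> S then 0 else walk_weight c (nonret_walks G S k (head G e) b)))"
proof -
  define P where "P e = (if head G e \<in> S then {} else nonret_walks G S k (head G e) b)" for e
  \<comment> \<open>Prepending an arc to a nonempty walk makes the former start, the head of
    \<open>e\<close>, an inner vertex.\<close>
  have inner: "set (inner_verts (e # p)) = insert (head G e) (set (inner_verts p))"
    if "awalk (head G e) p b" "length p = k" for e p
    using that assms by (cases p) (auto simp: inner_verts_def awalk_Cons_iff)
  have "nonret_walks G S (Suc k) u b = (\<Union>e\<in>out_arcs G u. (#) e ` P e)"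
    by (auto simp: P_def nonret_walks_def walks_def length_Suc_conv awalk_Cons_iff inner
        split: if_splits)
  moreover have "walk_weight c (P e) =
      (if head G e \<in> S then 0 else walk_weight c (nonret_walks G S k (head G e) b))" for e
    by (simp add: P_def walk_weight_def)
  moreover have "finite (P e)" for e
    by (simp add: P_def finite_nonret_walks)
  ultimately show ?thesis
    by (simp add: walk_weight_UN_Cons finite_out_arcs)
qed

text \<open>\<open>Suc k\<close> is the length of the walk up to its first visit to \<open>S\<close>
  after the start. The start \<open>u\<close> is arbitrary because the induction moves through
  vertices outside \<open>S\<close>. The last hypothesis excludes only the empty walk at
  \<open>b\<close>, where the sum is empty.\<close>

lemma first_return_decomposition:
  assumes "finite S" and "b \<in> S" and "l > 0 \<or> u \<noteq> b"
  shows "walk_weight c (walks G l u b) =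
    (\<Sum>k<l. \<Sum>s\<in>S. walk_weight c (nonret_walks G S (Suc k) u s) *
       walk_weight c (walks G (l - Suc k) s b))"
  using assms(3)
proof (induction l arbitrary: u)
  case 0
  then show ?case
    by (simp add: walk_weight_walks_0)
next
  case (Suc l)
  let ?W = "\<lambda>m s. walk_weight c (walks G m s b)"
  let ?N = "\<lambda>k u s. walk_weight c (nonret_walks G S k u s)"
  \<comment> \<open>The summand \<open>k = 0\<close>: the first arc already ends in
    \<open>S\<close>, and only \<open>s = head G e\<close> contributes.\<close>
  have returns: "(\<Sum>s\<in>S. ?N (Suc 0) u s * ?W l s) =
      (\<Sum>e\<in>out_arcs G u. c e * (if head G e \<in> S then ?W l (head G e) else 0))"
  proof -
    have single: "(\<Sum>s\<in>S. c e * (if head G e = s then 1 else 0) * ?W l s) =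
        c e * (if head G e \<in> S then ?W l (head G e) else 0)" for e
    proof -
      have "(\<Sum>s\<in>S. c e * (if head G e = s then 1 else 0) * ?W l s) =
          (\<Sum>s\<in>S. if head G e = s then c e * ?W l s else 0)"
        by (intro sum.cong) auto
      then show ?thesis
        using \<open>finite S\<close> by simp
    qed
    have "(\<Sum>s\<in>S. ?N (Suc 0) u s * ?W l s) =
        (\<Sum>e\<in>out_arcs G u. \<Sum>s\<in>S. c e * (if head G e = s then 1 else 0) * ?W l s)"
      by (subst sum.swap) (simp only: walk_weight_nonret_walks_1 sum_distrib_right)
    then show ?thesis
      by (simp only: single)
  qed
  \<comment> \<open>The other summands: the first arc ends outside \<open>S\<close>, and the
    induction hypothesis at its head reassembles all walks from there to \<open>b\<close>.\<close>
  have continues: "(\<Sum>k<l. \<Sum>s\<in>S. ?N (Suc (Suc k)) u s * ?W (l - Suc k) s) =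
      (\<Sum>e\<in>out_arcs G u. c e * (if head G e \<in> S then 0 else ?W l (head G e)))"
  proof -
    have "(\<Sum>s\<in>S. ?N (Suc (Suc k)) u s * ?W (l - Suc k) s) =
        (\<Sum>e\<in>out_arcs G u. c e * (if head G e \<in> S then 0
           else \<Sum>s\<in>S. ?N (Suc k) (head G e) s * ?W (l - Suc k) s))" (is "?L = _") for k
    proof -
      have "?L = (\<Sum>e\<in>out_arcs G u. \<Sum>s\<in>S. c e *
          (if head G e \<in> S then 0 else ?N (Suc k) (head G e) s) * ?W (l - Suc k) s)"
        by (subst sum.swap) (simp only: walk_weight_nonret_walks_Suc zero_less_Suc sum_distrib_right)
      then show ?thesis
        by (simp add: sum_distrib_left mult.assoc if_distrib cong: if_cong)
           (auto intro!: sum.cong simp: sum_distrib_left)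
    qed
    then have "(\<Sum>k<l. \<Sum>s\<in>S. ?N (Suc (Suc k)) u s * ?W (l - Suc k) s) =
        (\<Sum>e\<in>out_arcs G u. \<Sum>k<l. c e * (if head G e \<in> S then 0
           else \<Sum>s\<in>S. ?N (Suc k) (head G e) s * ?W (l - Suc k) s))"
      by (subst sum.swap) simp
    also have "\<dots> = (\<Sum>e\<in>out_arcs G u. c e * (if head G e \<in> S then 0 else ?W l (head G e)))"
    proof (rule sum.cong[OF refl])
      fix e
      show "(\<Sum>k<l. c e * (if head G e \<in> S then 0
           else \<Sum>s\<in>S. ?N (Suc k) (head G e) s * ?W (l - Suc k) s)) =
          c e * (if head G e \<in> S then 0 else ?W l (head G e))"
      proof (cases "head G e \<in> S")
        case False
        \<comment> \<open>This makes the induction hypothesis available even for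
          \<open>l = 0\<close>.\<close>
        with \<open>b \<in> S\<close> have "head G e \<noteq> b"
          by auto
        from Suc.IH[OF disjI2[OF this]] False show ?thesis
          by (simp add: sum_distrib_left)
      qed simp
    qed
    finally show ?thesis .
  qed
  have "?W (Suc l) u = (\<Sum>e\<in>out_arcs G u. c e * ?W l (head G e))"
    by (rule walk_weight_walks_Suc)
  also have "\<dots> = (\<Sum>s\<in>S. ?N (Suc 0) u s * ?W l s) +
      (\<Sum>k<l. \<Sum>s\<in>S. ?N (Suc (Suc k)) u s * ?W (l - Suc k) s)"
    \<comment> \<open>For each arc exactly one of the two conditionals yields the walks from its
      head.\<close>
    unfolding returns continues sum.distrib[symmetric] by (intro sum.cong) auto
  also have "\<dots> = (\<Sum>k<Suc l. \<Sum>s\<in>S. ?N (Suc k) u s * ?W (Suc l - Suc k) s)"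
    by (simp add: sum.lessThan_Suc_shift del: sum.lessThan_Suc)
  finally show ?case .
qed

text \<open>Compare coefficients: the constant term is the identity matrix, and in positive degree
  the Cauchy product is \<open>first_return_decomposition\<close>.\<close>

lemma walk_gf_eq:
  assumes "set vs \<subseteq> verts G" and "distinct vs"
  shows "walk_gf G c vs = 1\<^sub>m (length vs) + nonret_walk_gf G c vs * walk_gf G c vs"
    (is "?W = 1\<^sub>m ?n + ?N * ?W")
proof (rule eq_matI)
  show "dim_row ?W = dim_row (1\<^sub>m ?n + ?N * ?W)" "dim_col ?W = dim_col (1\<^sub>m ?n + ?N * ?W)"
    by (simp_all add: walk_gf_def nonret_walk_gf_def mat_series_def)
next
  fix i j assume "i < dim_row (1\<^sub>m ?n + ?N * ?W)" "j < dim_col (1\<^sub>m ?n + ?N * ?W)"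
  then have ij: "i < ?n" "j < ?n"
    by (simp_all add: walk_gf_def nonret_walk_gf_def mat_series_def)
  let ?w = "\<lambda>l a b. walk_weight c (walks G l a b)"
  let ?nr = "\<lambda>l a b. walk_weight c (nonret_walks G (set vs) l a b)"
  let ?M = "\<lambda>l. if l = 0 then 0\<^sub>m ?n ?n else nonret_walk_mat G c vs l"
  have prod_entry: "(nonret_walk_mat G c vs k * walk_mat G c vs m) $$ (i, j) =
      (\<Sum>s\<in>set vs. ?nr k (vs ! i) s * ?w m s (vs ! j))" for k m
  proof -
    have "(nonret_walk_mat G c vs k * walk_mat G c vs m) $$ (i, j) =
        (\<Sum>r<?n. ?nr k (vs ! i) (vs ! r) * ?w m (vs ! r) (vs ! j))"
      using ij by (simp add: nonret_walk_mat_def walk_mat_def scalar_prod_def lessThan_atLeast0)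
    also have "\<dots> = (\<Sum>s\<in>set vs. ?nr k (vs ! i) s * ?w m s (vs ! j))"
      \<comment> \<open>Distinctness makes matrix indices correspond bijectively to the vertices in
        \<open>S\<close>.\<close>
      using bij_betw_nth[OF \<open>distinct vs\<close> refl refl]
      by (rule sum.reindex_bij_betw)
    finally show ?thesis .
  qed
  have coeff: "fps_nth ((?N * ?W) $$ (i, j)) l = (\<Sum>k=0..l. (?M k * walk_mat G c vs (l - k)) $$ (i, j))"
    for l
    unfolding walk_gf_def nonret_walk_gf_def using ij
    by (intro mat_series_mult_coeff) (auto simp: nonret_walk_mat_def walk_mat_def)
  have zero: "(0\<^sub>m ?n ?n * walk_mat G c vs m) $$ (i, j) = 0" for m
    using ij by (subst left_mult_zero_mat) (auto simp: walk_mat_def)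
  have W: "fps_nth (?W $$ (i, j)) l = ?w l (vs ! i) (vs ! j)" for l
    using ij by (simp add: walk_gf_def mat_series_def walk_mat_def)
  have "fps_nth (?W $$ (i, j)) l = fps_nth (1\<^sub>m ?n $$ (i, j)) l + fps_nth ((?N * ?W) $$ (i, j)) l" for l
  proof (cases l)
    case 0
    have "vs ! i \<in> verts G"
      using assms(1) ij by auto
    moreover have "fps_nth ((?N * ?W) $$ (i, j)) 0 = 0"
      by (simp add: coeff zero)
    ultimately show ?thesis
      using ij \<open>distinct vs\<close> 0 by (simp add: W walk_weight_walks_0 nth_eq_iff_index_eq)
  next
    case (Suc m)
    \<comment> \<open>The term of the Cauchy product with index 0 vanishes, so the index shifts by
      one.\<close>
    have "fps_nth ((?N * ?W) $$ (i, j)) l =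
        (\<Sum>k\<le>m. (nonret_walk_mat G c vs (Suc k) * walk_mat G c vs (m - k)) $$ (i, j))"
      by (simp add: coeff zero Suc sum.atMost_Suc_shift atLeast0AtMost del: sum.atMost_Suc)
    also have "\<dots> = ?w l (vs ! i) (vs ! j)"
      using ij
      by (simp only: prod_entry Suc first_return_decomposition[of "set vs" "vs ! j" "Suc m"]
          lessThan_Suc_atMost diff_Suc_Suc nth_mem finite_set zero_less_Suc simp_thms)
    finally show ?thesis
      using ij Suc by (simp add: W)
  qed
  then show "?W $$ (i, j) = (1\<^sub>m ?n + ?N * ?W) $$ (i, j)"
    using ij by (intro fps_ext) (simp add: walk_gf_def nonret_walk_gf_def mat_series_def)
qed

end

theorem theorem2p14:
  fixes G :: "('v, 'e) pre_digraph" and c :: "'e \<Rightarrow> 'r :: comm_ring_1"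
    and S :: "'v set" and vs :: "'v list"
  assumes "fin_digraph G"
    and "S \<subseteq> verts G" and "S \<noteq> {}"
    and "distinct vs" and "set vs = S"
  shows "inverts_mat (1\<^sub>m (card S) - nonret_walk_gf G c vs) (walk_gf G c vs)
    \<and> inverts_mat (walk_gf G c vs) (1\<^sub>m (card S) - nonret_walk_gf G c vs)"
proof -
  interpret fin_digraph G by fact
  let ?n = "length vs" and ?N = "nonret_walk_gf G c vs" and ?W = "walk_gf G c vs"
  have n: "card S = ?n"
    using assms(4,5) distinct_card by blast
  have N: "?N \<in> carrier_mat ?n ?n" and W: "?W \<in> carrier_mat ?n ?n"
    by (simp_all add: nonret_walk_gf_def walk_gf_def mat_series_def)
  have eq: "?W = 1\<^sub>m ?n + ?N * ?W"
    using assms by (intro walk_gf_eq) auto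
  have "(1\<^sub>m ?n - ?N) * ?W = ?W - ?N * ?W"
    using N W by (simp add: minus_mult_distrib_mat[where nr = ?n and n = ?n and nc = ?n])
  also have "\<dots> = (1\<^sub>m ?n + ?N * ?W) - ?N * ?W"
    using eq by simp
  also have "\<dots> = 1\<^sub>m ?n"
    using N W by (intro eq_matI) auto
  finally have "(1\<^sub>m ?n - ?N) * ?W = 1\<^sub>m ?n" .
  \<comment> \<open>The entries lie in the power series ring over \<open>'r\<close>, which is again
    commutative, so the adjugate argument applies.\<close>
  moreover from this have "?W * (1\<^sub>m ?n - ?N) = 1\<^sub>m ?n"
    using N W by (intro comm_ring_mat_mult_left_right_inverse[of "1\<^sub>m ?n - ?N" ?n]) auto
  ultimately show ?thesis
    using N W by (simp add: inverts_mat_def n)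
qed

end
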